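(* For all integers $n\geq 0$, \begin{align*} \overline{OPT}_3(3n+1)&\equiv 0 \pmod{6},\\ \overline{OPT}_3(12n+7)&\equiv 0 \pmod{12},\\ \overline{OPT}_3(12n+10)&\equiv 0 \pmod{12},\\ \overline{OPT}_3(3n+2)&\equiv 0 \pmod{18},\\ \overline{OPT}_3(6n+5)&\equiv 0\pmod{36},\\ \overline{OPT}_3(24n+23)&\equiv 0\pmod{144}. \end{align*}
   Context: For a positive integer $m$ let $f_m:=(q^m;q^m)_\infty=\prod_{i\ge 1}(1-q^{mi})$ (as a formal power series in $q$). For a positive integer $k$ and integers $n\ge 0$, $\overline{OPT}_k(n)$ denotes the number of overpartition $k$-tuples of $n$ with all parts odd: $k$-tuples $(\xi_1,\dots,\xi_k)$ of overpartitions (partitions in which the first occurrence of each part size may be overlined) with all parts odd and total sum of all parts equal to $n$. Its generating function is $$\sum_{n\geq 0}\overline{OPT}_k(n)q^n=\frac{f_{2}^{3k}}{f_{1}^{2k}f_{4}^{k}}.$$ *)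

theory Defs
  imports "HOL-Library.Multiset" "HOL-Number_Theory.Cong"
begin

(* An overpartition is encoded as a pair (M, S): M is the multiset of its parts and
   S is the set of part sizes whose first occurrence is overlined. *)
type_synonym overpartition = "nat multiset \<times> nat set"

definition is_overpartition :: "overpartition \<Rightarrow> bool" where
  "is_overpartition \<xi> \<longleftrightarrow> (\<forall>p \<in># fst \<xi>. 0 < p) \<and> snd \<xi> \<subseteq> set_mset (fst \<xi>)"

definition all_parts_odd :: "overpartition \<Rightarrow> bool" where
  "all_parts_odd \<xi> \<longleftrightarrow> (\<forall>p \<in># fst \<xi>. odd p)"

definition weight :: "overpartition \<Rightarrow> nat" where
  "weight \<xi> = \<Sum>\<^sub># (fst \<xi>)"

definition opt_tuples :: "nat \<Rightarrow> nat \<Rightarrow> overpartition list set" where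
  "opt_tuples k n =
     {\<xi>s. length \<xi>s = k \<and> (\<forall>\<xi> \<in> set \<xi>s. is_overpartition \<xi> \<and> all_parts_odd \<xi>)
         \<and> (\<Sum>\<xi>\<leftarrow>\<xi>s. weight \<xi>) = n}"

definition OPT :: "nat \<Rightarrow> nat \<Rightarrow> nat" where
  "OPT k n = card (opt_tuples k n)"

lemma finite_overpartitions_le: "finite {\<xi>. is_overpartition \<xi> \<and> weight \<xi> \<le> n}"
proof -
  let ?L = "{xs :: nat list. set xs \<subseteq> {..n} \<and> length xs \<le> n}"
  have parts: "set_mset M \<subseteq> {..n} \<and> size M \<le> n"
    if "\<forall>p \<in># M. 0 < p" "\<Sum>\<^sub># M \<le> n" for M :: "nat multiset"
    using that
  proof (induction M arbitrary: n)
    case empty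
    then show ?case by simp
  next
    case (add x M)
    then have "set_mset M \<subseteq> {..n - x} \<and> size M \<le> n - x" by simp
    with add.prems show ?case by fastforce
  qed
  have "{\<xi>. is_overpartition \<xi> \<and> weight \<xi> \<le> n} \<subseteq> mset ` ?L \<times> Pow {..n}"
  proof
    fix \<xi> assume "\<xi> \<in> {\<xi>. is_overpartition \<xi> \<and> weight \<xi> \<le> n}"
    then have p: "set_mset (fst \<xi>) \<subseteq> {..n}" "size (fst \<xi>) \<le> n" "snd \<xi> \<subseteq> set_mset (fst \<xi>)"
      using parts[of "fst \<xi>"] by (auto simp: is_overpartition_def weight_def)
    obtain xs where xs: "mset xs = fst \<xi>" using ex_mset by blast
    have "set xs = set_mset (fst \<xi>)" "length xs = size (fst \<xi>)"
      using xs by (metis set_mset_mset, metis size_mset)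
    then have "xs \<in> ?L" using p by simp
    then show "\<xi> \<in> mset ` ?L \<times> Pow {..n}"
      using xs p by (cases \<xi>) auto
  qed
  then show ?thesis
    by (rule finite_subset) (simp add: finite_lists_length_le)
qed

lemma finite_opt_tuples: "finite (opt_tuples k n)"
proof -
  have "opt_tuples k n \<subseteq>
      {\<xi>s. set \<xi>s \<subseteq> {\<xi>. is_overpartition \<xi> \<and> weight \<xi> \<le> n} \<and> length \<xi>s = k}"
    by (auto simp: opt_tuples_def intro!: member_le_sum_list)
  then show ?thesis
    by (rule finite_subset) (intro finite_lists_length_eq finite_overpartitions_le)
qed

end

theory Submission
  imports Defs "HOL-Computational_Algebra.Formal_Power_Series"
begin

text \<open>Let \<open>A = \<Sum> OPT 3 n q\<^sup>n\<close> and \<open>S = \<Sum> \<sigma>(n) q\<^sup>n\<close> over odd \<open>n\<close>. Logarithmic differentiation of the product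
  for \<open>A\<close> gives \<open>q A' = 6 S A\<close>, that is \<open>n OPT 3 n = 6 \<Sum> \<sigma>(j) OPT 3 (n - j)\<close> over odd \<open>j\<close>. This yields
  the factor 3 if \<open>n\<close> is prime to 3, and then the factor 9 if \<open>n \<equiv> 2 (mod 3)\<close>, because \<open>3\<close> divides
  \<open>\<sigma>(j)\<close> whenever \<open>j \<equiv> 2 (mod 3)\<close>.

  For powers of 2, \<open>S\<close> is odd, so the equation also gives \<open>A(q) A(-q) = 1\<close>. With \<open>A = 1 + 2 (e + o)\<close>
  split by parity this reads \<open>e = o\<^sup>2 - e\<^sup>2\<close>, and \<open>q o' = 3 S (1 + 2 e)\<close>. Modulo 2, \<open>\<sigma>\<close> at odd arguments
  detects squares, hence \<open>e + o \<equiv> \<Sum> \<theta>(q\<^sup>k)\<close> over the powers \<open>k\<close> of 2, where \<open>\<theta> = \<Sum> q\<^bsup>t\<^sup>2\<^esup>\<close> over odd \<open>t > 0\<close>.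
  This settles the factor 4. For \<open>n \<equiv> 7 (mod 8)\<close>, \<open>8\<close> divides \<open>\<sigma>(n)\<close>, and the factor 16 amounts to the
  coefficient of \<open>S (o\<^sup>2 - e\<^sup>2)\<close> being divisible by 4; the two halves agree because
  \<open>\<sigma>(j) \<equiv> 2 #{(x, y). x\<^sup>2 + 4 y\<^sup>2 = j} (mod 4)\<close> for \<open>j \<equiv> 5 (mod 8)\<close>, a consequence of Zagier's
  involution.\<close>

unbundle fps_syntax

section \<open>Generating functions of overpartitions\<close>

text \<open>\<open>Q\<close> is a parameter so that the set of odd part sizes can be approached one
  size at a time.\<close>

definition overpartitions_in :: "nat set \<Rightarrow> nat \<Rightarrow> overpartition set" where
  "overpartitions_in Q n = {\<xi>. is_overpartition \<xi> \<and> set_mset (fst \<xi>) \<subseteq> Q \<and> weight \<xi> = n}"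

definition overpartition_gf :: "nat set \<Rightarrow> int fps" where
  "overpartition_gf Q = Abs_fps (\<lambda>n. int (card (overpartitions_in Q n)))"

lemma finite_overpartitions_in: "finite (overpartitions_in Q n)"
  by (rule finite_subset[OF _ finite_overpartitions_le[of n]]) (auto simp: overpartitions_in_def)

lemma overpartition_gf_empty: "overpartition_gf {} = 1"
proof -
  have "overpartitions_in {} n = (if n = 0 then {({#}, {})} else {})" for n
    by (auto simp: overpartitions_in_def is_overpartition_def weight_def)
  then show ?thesis
    by (simp add: overpartition_gf_def fps_eq_iff)
qed

lemma part_le_weight: "p \<in># fst \<xi> \<Longrightarrow> p \<le> weight \<xi>"
  unfolding weight_def by (metis le_add1 multi_member_split sum_mset.add_mset)

lemma fps_X_deriv_nth: "(fps_X * fps_deriv F) $ n = of_nat n * F $ n" for F :: "'a::comm_ring_1 fps"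
  by (cases n) simp_all

lemma fps_numeral_mult_nth: "(numeral k * F) $ n = numeral k * F $ n" for F :: "'a::comm_ring_1 fps"
  by (simp add: numeral_fps_const)

text \<open>\<open>Z\<close> counts the overpartitions with parts in \<open>insert m Q\<close> in which \<open>m\<close> is not overlined;
  adding a part \<open>m\<close>, overlined or not, is injective on these.\<close>

lemma overpartition_gf_insert:
  assumes "m \<notin> Q" "0 < m"
  obtains Z where "overpartition_gf (insert m Q) = (1 + fps_X ^ m) * Z"
    and "overpartition_gf Q = (1 - fps_X ^ m) * Z"
proof -
  let ?P = "overpartitions_in (insert m Q)"
  define B where "B n = {\<xi> \<in> ?P n. m \<notin> snd \<xi>}" for n
  define Z :: "int fps" where "Z = Abs_fps (\<lambda>n. int (card (B n)))"
  have fin: "finite (B n)" for n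
    using finite_overpartitions_in unfolding B_def by simp
  have overlined: "card {\<xi> \<in> ?P n. m \<in> snd \<xi>} = (if n < m then 0 else card (B (n - m)))" for n
  proof -
    let ?f = "\<lambda>\<xi>::overpartition. (add_mset m (fst \<xi>), insert m (snd \<xi>))"
    have le: "m \<le> n" if "\<xi> \<in> ?P n" "m \<in> snd \<xi>" for \<xi>
      using that part_le_weight[of m \<xi>] by (auto simp: overpartitions_in_def is_overpartition_def)
    have eq: "{\<xi> \<in> ?P n. m \<in> snd \<xi>} = ?f ` B (n - m)" if "m \<le> n"
    proof (intro equalityI subsetI)
      fix \<xi> assume a: "\<xi> \<in> {\<xi> \<in> ?P n. m \<in> snd \<xi>}"
      then have "m \<in># fst \<xi>" by (auto simp: overpartitions_in_def is_overpartition_def)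
      then obtain M where M: "fst \<xi> = add_mset m M" by (auto dest: multi_member_split)
      let ?\<eta> = "(M, snd \<xi> - {m})"
      have "\<xi> = ?f ?\<eta>" using a M by (cases \<xi>) auto
      moreover have "?\<eta> \<in> B (n - m)"
        using a M by (auto simp: B_def overpartitions_in_def is_overpartition_def weight_def)
      ultimately show "\<xi> \<in> ?f ` B (n - m)" by (rule image_eqI)
    next
      fix \<xi> assume "\<xi> \<in> ?f ` B (n - m)"
      then obtain \<eta> where "\<xi> = ?f \<eta>" "\<eta> \<in> B (n - m)" by blast
      then show "\<xi> \<in> {\<xi> \<in> ?P n. m \<in> snd \<xi>}"
        using that assms(2) by (auto simp: B_def overpartitions_in_def is_overpartition_def weight_def)
    qed
    have inj: "inj_on ?f (B (n - m))"
      by (auto simp: inj_on_def B_def dest: insert_ident)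
    have emp: "{\<xi> \<in> ?P n. m \<in> snd \<xi>} = {}" if "n < m" using le that by force
    show ?thesis
    proof (cases "n < m")
      case True
      then show ?thesis by (simp only: emp if_True card.empty)
    next
      case False
      then have "m \<le> n" by simp
      show ?thesis using card_image[OF inj] unfolding eq[OF \<open>m \<le> n\<close>] by (simp only: False if_False)
    qed
  qed
  have plain: "card {\<xi> \<in> B n. m \<in># fst \<xi>} = (if n < m then 0 else card (B (n - m)))" for n
  proof -
    let ?f = "\<lambda>\<xi>::overpartition. (add_mset m (fst \<xi>), snd \<xi>)"
    have le: "m \<le> n" if "\<xi> \<in> B n" "m \<in># fst \<xi>" for \<xi>
      using that part_le_weight[of m \<xi>] by (auto simp: B_def overpartitions_in_def)
    have eq: "{\<xi> \<in> B n. m \<in># fst \<xi>} = ?f ` B (n - m)" if "m \<le> n"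
    proof (intro equalityI subsetI)
      fix \<xi> assume a: "\<xi> \<in> {\<xi> \<in> B n. m \<in># fst \<xi>}"
      then obtain M where M: "fst \<xi> = add_mset m M" by (auto dest: multi_member_split)
      let ?\<eta> = "(M, snd \<xi>)"
      have "\<xi> = ?f ?\<eta>" using a M by (cases \<xi>) auto
      moreover have "?\<eta> \<in> B (n - m)"
        using a M by (auto simp: B_def overpartitions_in_def is_overpartition_def weight_def)
      ultimately show "\<xi> \<in> ?f ` B (n - m)" by (rule image_eqI)
    next
      fix \<xi> assume "\<xi> \<in> ?f ` B (n - m)"
      then obtain \<eta> where "\<xi> = ?f \<eta>" "\<eta> \<in> B (n - m)" by blast
      then show "\<xi> \<in> {\<xi> \<in> B n. m \<in># fst \<xi>}"
        using that assms(2) by (auto simp: B_def overpartitions_in_def is_overpartition_def weight_def)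
    qed
    have inj: "inj_on ?f (B (n - m))"
      by (auto simp: inj_on_def B_def)
    have emp: "{\<xi> \<in> B n. m \<in># fst \<xi>} = {}" if "n < m" using le that by force
    show ?thesis
    proof (cases "n < m")
      case True
      then show ?thesis by (simp only: emp if_True card.empty)
    next
      case False
      then have "m \<le> n" by simp
      show ?thesis using card_image[OF inj] unfolding eq[OF \<open>m \<le> n\<close>] by (simp only: False if_False)
    qed
  qed
  have "card (?P n) = card (B n) + (if n < m then 0 else card (B (n - m)))" for n
  proof -
    have "card (?P n) = card (B n \<union> {\<xi> \<in> ?P n. m \<in> snd \<xi>})"
      by (rule arg_cong[where f = card]) (auto simp: B_def)
    also have "card (B n \<union> {\<xi> \<in> ?P n. m \<in> snd \<xi>}) = card (B n) + card {\<xi> \<in> ?P n. m \<in> snd \<xi>}"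
      by (intro card_Un_disjoint fin) (auto simp: B_def finite_overpartitions_in)
    finally show ?thesis by (simp only: overlined)
  qed
  then have "overpartition_gf (insert m Q) = (1 + fps_X ^ m) * Z"
    by (auto simp: fps_eq_iff overpartition_gf_def Z_def distrib_right fps_X_power_mult_nth)
  moreover have "card (B n) = card (overpartitions_in Q n) + (if n < m then 0 else card (B (n - m)))" for n
  proof -
    have Q: "overpartitions_in Q n = {\<xi> \<in> B n. m \<notin># fst \<xi>}"
      using assms(1) by (auto simp: B_def overpartitions_in_def is_overpartition_def)
    have "card (B n) = card ({\<xi> \<in> B n. m \<notin># fst \<xi>} \<union> {\<xi> \<in> B n. m \<in># fst \<xi>})"
      by (rule arg_cong[where f = card]) auto
    also have "card ({\<xi> \<in> B n. m \<notin># fst \<xi>} \<union> {\<xi> \<in> B n. m \<in># fst \<xi>}) =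
        card {\<xi> \<in> B n. m \<notin># fst \<xi>} + card {\<xi> \<in> B n. m \<in># fst \<xi>}"
      by (rule card_Un_disjoint) (use fin in auto)
    finally show ?thesis by (simp only: plain Q)
  qed
  then have "overpartition_gf Q = (1 - fps_X ^ m) * Z"
    by (auto simp: fps_eq_iff overpartition_gf_def Z_def left_diff_distrib fps_X_power_mult_nth)
  ultimately show ?thesis using that by blast
qed

text \<open>A new size \<open>m\<close> multiplies the series by (1 + q^m)/(1 - q^m), which is 1
  modulo 2.\<close>

lemma overpartition_gf_mod_2:
  assumes "finite Q" "0 \<notin> Q"
  shows "2 dvd overpartition_gf Q - 1"
  using assms
proof (induction Q rule: finite_induct)
  case (insert m Q)
  obtain Z where "overpartition_gf (insert m Q) = (1 + fps_X ^ m) * Z"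
      and "overpartition_gf Q = (1 - fps_X ^ m) * Z"
    using overpartition_gf_insert[of m Q] insert by auto
  then have "overpartition_gf (insert m Q) - 1 = overpartition_gf Q - 1 + 2 * (fps_X ^ m * Z)"
    by (simp add: algebra_simps)
  moreover have "2 dvd overpartition_gf Q - 1" using insert by simp
  ultimately show ?case by (simp only: dvd_add dvd_triv_left)
qed (simp add: overpartition_gf_empty)

section \<open>Logarithmic derivative of the product\<close>

definition odd_multiples_gf :: "nat \<Rightarrow> int fps" where
  "odd_multiples_gf m = Abs_fps (\<lambda>n. if m dvd n \<and> odd (n div m) then 1 else 0)"

text \<open>A geometric series with ratio q^(2m). Its value q^m/(1 - q^(2m)), times 2m, is the
  logarithmic derivative (with respect to q d/dq) of (1 + q^m)/(1 - q^m).\<close>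

lemma odd_multiples_gf_closed:
  assumes "0 < m"
  shows "(1 - fps_X ^ (2 * m)) * odd_multiples_gf m = fps_X ^ m"
proof (rule fps_ext)
  fix n
  have "(if m dvd n \<and> odd (n div m) then 1 else (0::int)) =
      (if n = m then 1 else 0) + (if n < 2 * m then 0 else
        if m dvd (n - 2 * m) \<and> odd ((n - 2 * m) div m) then 1 else 0)"
  proof (cases "n < 2 * m")
    case True
    have "m dvd n \<and> odd (n div m) \<longleftrightarrow> n = m"
    proof
      assume a: "m dvd n \<and> odd (n div m)"
      then obtain k where k: "n = m * k" by blast
      with a True assms have "k < 2" "odd k" by auto
      then have "k = 1" by presburger
      with k show "n = m" by simp
    qed (use assms in auto)
    with True show ?thesis by simp
  next
    case False
    then obtain r where r: "n = r + 2 * m" by (metis add.commute le_Suc_ex not_less)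
    have "m dvd n \<longleftrightarrow> m dvd r" using r by (simp add: dvd_add_left_iff)
    moreover have "n div m = r div m + 2" using r assms by simp
    ultimately show ?thesis using r False assms by auto
  qed
  then show "((1 - fps_X ^ (2 * m)) * odd_multiples_gf m) $ n = fps_X ^ m $ n"
    by (auto simp: odd_multiples_gf_def left_diff_distrib fps_X_power_mult_nth fps_X_power_nth)
qed

lemma overpartition_gf_log_deriv:
  assumes "finite Q" "0 \<notin> Q"
  shows "fps_X * fps_deriv (overpartition_gf Q) =
    2 * (\<Sum>m\<in>Q. of_nat m * odd_multiples_gf m) * overpartition_gf Q"
  using assms
proof (induction Q rule: finite_induct)
  case (insert m Q)
  let ?L = "\<Sum>m\<in>Q. of_nat m * odd_multiples_gf m" and ?C = "overpartition_gf Q"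
    and ?D = "overpartition_gf (insert m Q)" and ?q = "fps_X ^ m :: int fps"
  have m: "0 < m" using insert by auto
  obtain Z where Z: "?D = (1 + ?q) * Z" "?C = (1 - ?q) * Z"
    using overpartition_gf_insert[of m Q] insert m by auto
  have dq: "fps_X * fps_deriv ?q = of_nat m * ?q"
    by (rule fps_ext) (simp only: fps_X_deriv_nth, simp add: fps_X_power_nth flip: fps_of_nat)
  have l: "(1 - ?q * ?q) * odd_multiples_gf m = ?q"
    using odd_multiples_gf_closed[OF m] by (simp add: mult_2 power_add)
  have IH: "fps_X * fps_deriv ?C = 2 * ?L * ?C" using insert by auto
  then have 1: "(1 - ?q) * (fps_X * fps_deriv Z) = of_nat m * ?q * Z + 2 * ?L * (1 - ?q) * Z"
    unfolding Z using dq by (simp add: algebra_simps)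
  have 2: "fps_X * fps_deriv ?D = of_nat m * ?q * Z + (1 + ?q) * (fps_X * fps_deriv Z)"
    unfolding Z using dq by (simp add: algebra_simps)
  \<comment> \<open>Working with this multiple avoids dividing by 1 - q^m; the factor is cancelled
    at the end.\<close>
  have "(1 - ?q) * (fps_X * fps_deriv ?D) =
      of_nat m * ?q * Z * (1 - ?q) + (1 + ?q) * ((1 - ?q) * (fps_X * fps_deriv Z))"
    unfolding 2 by (simp add: algebra_simps)
  also have "\<dots> = 2 * of_nat m * Z * ?q + 2 * ?L * (1 - ?q) * ?D"
    unfolding 1 Z by (simp add: algebra_simps)
  also have "2 * of_nat m * Z * ?q = 2 * of_nat m * Z * ((1 - ?q * ?q) * odd_multiples_gf m)"
    by (simp only: l)
  also have "\<dots> + 2 * ?L * (1 - ?q) * ?D = (1 - ?q) * (2 * (of_nat m * odd_multiples_gf m + ?L) * ?D)"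
    unfolding Z by (simp add: algebra_simps)
  finally have "(1 - ?q) * (fps_X * fps_deriv ?D) =
      (1 - ?q) * (2 * (of_nat m * odd_multiples_gf m + ?L) * ?D)" .
  moreover have "1 - ?q \<noteq> 0"
  proof
    assume "1 - ?q = 0"
    then have "(1 - ?q) $ 0 = 0" by simp
    with m show False by simp
  qed
  ultimately show ?case using insert by simp
qed (simp add: overpartition_gf_empty)

text \<open>This is the sum over odd m of m (q^m + q^(3m) + ...): n = m k with m and k odd forces n
  odd, and then every divisor m of n occurs.\<close>

definition odd_sigma_gf :: "int fps" where
  "odd_sigma_gf = Abs_fps (\<lambda>n. if odd n then int (\<Sum>d | d dvd n. d) else 0)"

definition odd_overpartition_gf :: "int fps" where
  "odd_overpartition_gf = overpartition_gf {m. odd m}"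

text \<open>No part exceeds the weight, so each coefficient is already that of a finite product, to
  which the inductions apply.\<close>

lemma overpartition_gf_truncate:
  assumes "n \<le> N"
  shows "odd_overpartition_gf $ n = overpartition_gf {m. odd m \<and> m \<le> N} $ n"
proof -
  have "overpartitions_in {m. odd m} n = overpartitions_in {m. odd m \<and> m \<le> N} n"
    using assms order.trans[OF part_le_weight] by (auto simp: overpartitions_in_def)
  then show ?thesis by (simp add: odd_overpartition_gf_def overpartition_gf_def)
qed

lemma odd_overpartition_gf_mod_2: "2 dvd odd_overpartition_gf $ n - 1 $ n"
proof -
  have "2 dvd overpartition_gf {m. odd m \<and> m \<le> n} - 1"
    by (rule overpartition_gf_mod_2) auto
  then obtain F where "overpartition_gf {m. odd m \<and> m \<le> n} - 1 = 2 * F" by blast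
  then have "overpartition_gf {m. odd m \<and> m \<le> n} $ n - 1 $ n = 2 * F $ n"
    by (metis fps_sub_nth fps_numeral_mult_nth)
  then show ?thesis by (simp only: overpartition_gf_truncate[OF order.refl] dvd_triv_left)
qed

lemma odd_overpartition_gf_log_deriv:
  "fps_X * fps_deriv odd_overpartition_gf = 2 * odd_sigma_gf * odd_overpartition_gf"
proof (rule fps_ext)
  fix n :: nat
  let ?Q = "{m. odd m \<and> m \<le> n}"
  have fin: "finite ?Q" by (rule finite_subset[of _ "{..n}"]) auto
  have L: "(\<Sum>m\<in>?Q. of_nat m * odd_multiples_gf m) $ i = odd_sigma_gf $ i" if "i \<le> n" for i
  proof -
    have "(\<Sum>m\<in>?Q. of_nat m * odd_multiples_gf m) $ i =
        (\<Sum>m\<in>?Q. if m dvd i \<and> odd (i div m) then int m else 0)"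
      unfolding fps_sum_nth
      by (intro sum.cong refl) (simp add: odd_multiples_gf_def fps_of_nat[symmetric])
    also have "\<dots> = (\<Sum>m | m \<in> ?Q \<and> m dvd i \<and> odd (i div m). int m)"
      by (rule sum.inter_filter[OF fin, symmetric])
    also have "\<dots> = (if odd i then \<Sum>m | m dvd i. int m else 0)"
    proof -
      have "m \<in> ?Q \<and> m dvd i \<and> odd (i div m) \<longleftrightarrow> odd i \<and> m dvd i" for m
      proof (cases "odd i \<and> m dvd i")
        case True
        then have "i = m * (i div m)" "m \<le> i" by (auto simp: odd_pos dvd_imp_le)
        with True that show ?thesis by (metis even_mult_iff mem_Collect_eq order.trans)
      next
        case False
        then show ?thesis by (metis dvd_mult_div_cancel even_mult_iff mem_Collect_eq)
      qed
      then have "{m. m \<in> ?Q \<and> m dvd i \<and> odd (i div m)} = (if odd i then {m. m dvd i} else {})"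
        by auto
      then show ?thesis by simp
    qed
    finally show ?thesis by (simp add: odd_sigma_gf_def)
  qed
  have "(fps_X * fps_deriv odd_overpartition_gf) $ n = (fps_X * fps_deriv (overpartition_gf ?Q)) $ n"
    by (cases n) (simp_all add: overpartition_gf_truncate)
  also have "\<dots> = (2 * ((\<Sum>m\<in>?Q. of_nat m * odd_multiples_gf m) * overpartition_gf ?Q)) $ n"
    using overpartition_gf_log_deriv[of ?Q] by (simp add: mult.assoc)
  also have "\<dots> = (2 * (odd_sigma_gf * odd_overpartition_gf)) $ n"
    unfolding fps_numeral_mult_nth fps_mult_nth
    by (intro arg_cong[where f = "\<lambda>x. 2 * x"] sum.cong refl) (simp add: L overpartition_gf_truncate[of _ n])
  finally show "(fps_X * fps_deriv odd_overpartition_gf) $ n = (2 * odd_sigma_gf * odd_overpartition_gf) $ n"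
    by (simp add: mult.assoc)
qed

lemma OPT_gf: "Abs_fps (\<lambda>n. int (OPT k n)) = odd_overpartition_gf ^ k"
proof (induction k)
  case 0
  have "opt_tuples 0 n = (if n = 0 then {[]} else {})" for n
    by (auto simp: opt_tuples_def)
  then show ?case by (simp add: fps_eq_iff OPT_def)
next
  case (Suc k)
  have "int (OPT (Suc k) n) = (odd_overpartition_gf * Abs_fps (\<lambda>n. int (OPT k n))) $ n" for n
  proof -
    let ?O = "overpartitions_in {m. odd m}"
    let ?f = "\<lambda>(\<xi>, \<xi>s). \<xi> # \<xi>s"
    \<comment> \<open>A nonempty tuple is a head of weight at most \<open>n\<close> and a tuple for
      the remaining weight; grouping the heads by weight gives the Cauchy product.\<close>
    have "opt_tuples (Suc k) n = ?f ` (SIGMA \<xi> : (\<Union>i\<in>{0..n}. ?O i). opt_tuples k (n - weight \<xi>))"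
      by (force simp: opt_tuples_def overpartitions_in_def all_parts_odd_def length_Suc_conv image_iff)
    then have "OPT (Suc k) n = card (SIGMA \<xi> : (\<Union>i\<in>{0..n}. ?O i). opt_tuples k (n - weight \<xi>))"
      unfolding OPT_def by (simp only:) (rule card_image, auto simp: inj_on_def)
    also have "\<dots> = (\<Sum>\<xi>\<in>(\<Union>i\<in>{0..n}. ?O i). OPT k (n - weight \<xi>))"
      by (subst card_SigmaI) (auto simp: finite_overpartitions_in finite_opt_tuples OPT_def)
    also have "\<dots> = (\<Sum>i=0..n. \<Sum>\<xi>\<in>?O i. OPT k (n - weight \<xi>))"
      by (rule sum.UNION_disjoint) (simp_all add: finite_overpartitions_in, auto simp: overpartitions_in_def)
    also have "\<dots> = (\<Sum>i=0..n. card (?O i) * OPT k (n - i))"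
      by (intro sum.cong refl) (simp add: overpartitions_in_def)
    finally show ?thesis
      by (simp add: fps_mult_nth odd_overpartition_gf_def overpartition_gf_def)
  qed
  then show ?case using Suc by (simp add: fps_eq_iff)
qed

section \<open>Divisor sums\<close>

text \<open>Orbits of length two contribute an even amount; they are removed one at a time.\<close>

lemma involution_sum_mod_2:
  fixes g :: "'a \<Rightarrow> int"
  assumes "finite A" "\<And>x. x \<in> A \<Longrightarrow> f x \<in> A" "\<And>x. x \<in> A \<Longrightarrow> f (f x) = x"
    and "\<And>x. x \<in> A \<Longrightarrow> g (f x) = g x"
  shows "even (sum g A) \<longleftrightarrow> even (sum g {x \<in> A. f x = x})"
  using assms
proof (induction A rule: finite_psubset_induct)
  case (psubset A)
  show ?case
  proof (cases "\<exists>x\<in>A. f x \<noteq> x")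
    case False
    then have "{x \<in> A. f x = x} = A" by auto
    then show ?thesis by simp
  next
    case True
    then obtain x where x: "x \<in> A" "f x \<noteq> x" by blast
    let ?B = "A - {x, f x}"
    have inv: "f y \<in> A" "f (f y) = y" "g (f y) = g y" if "y \<in> A" for y
      using that psubset.prems by auto
    have "even (sum g ?B) \<longleftrightarrow> even (sum g {y \<in> ?B. f y = y})"
    proof (rule psubset.IH)
      show "?B \<subset> A" using x by blast
      show "f y \<in> ?B" if "y \<in> ?B" for y using that inv x by (metis Diff_iff insert_iff singletonD)
    qed (use inv in auto)
    moreover have "{y \<in> ?B. f y = y} = {y \<in> A. f y = y}" using x inv(2) by auto
    moreover have "sum g A = sum g ?B + 2 * g x"
    proof -
      have "sum g A = sum g ?B + sum g {x, f x}"
        using psubset.hyps x inv(1) by (intro sum.subset_diff) auto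
      then show ?thesis using x inv(3) by simp
    qed
    ultimately show ?thesis by simp
  qed
qed

lemma involution_card_mod_2:
  assumes "finite A" "\<And>x. x \<in> A \<Longrightarrow> f x \<in> A" "\<And>x. x \<in> A \<Longrightarrow> f (f x) = x"
  shows "even (card A) \<longleftrightarrow> even (card {x \<in> A. f x = x})"
  using involution_sum_mod_2[of A f "\<lambda>_. 1"] assms by simp

text \<open>Complementary divisors d and n/d lie on opposite sides of the square root; the last sum
  is the root itself, or empty if \<open>n\<close> is not a square.\<close>

lemma sum_divisors_pairs:
  fixes n :: nat
  assumes "0 < n"
  shows "(\<Sum>d | d dvd n. d) = (\<Sum>d | d dvd n \<and> d * d < n. d + n div d) + (\<Sum>d | d * d = n. d)"
proof -
  let ?A = "{d. d dvd n \<and> d * d < n}" and ?B = "{d. d dvd n \<and> n < d * d}" and ?C = "{d. d * d = n}"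
  have fin: "finite {d. d dvd n}" using assms by simp
  have fins: "finite ?A" "finite ?B" "finite ?C"
    by (rule finite_subset[OF _ fin], force)+
  have "bij_betw (\<lambda>d. n div d) ?A ?B"
  proof (rule bij_betwI[where g = "\<lambda>d. n div d"])
    have *: "\<exists>e. n = d * e \<and> n div d = e \<and> n div e = d \<and> d > 0 \<and> e > 0" if "d dvd n" for d
      using that assms by (auto elim!: dvdE)
    show "(\<lambda>d. n div d) \<in> ?A \<rightarrow> ?B" "(\<lambda>d. n div d) \<in> ?B \<rightarrow> ?A"
      using * by (force simp: mult.commute)+
    show "n div (n div d) = d" if "d \<in> ?A" for d using * that by blast
    show "n div (n div d) = d" if "d \<in> ?B" for d using * that by blast
  qed
  then have "(\<Sum>d\<in>?A. n div d) = (\<Sum>d\<in>?B. d)"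
    by (rule sum.reindex_bij_betw)
  moreover have "(\<Sum>d | d dvd n. d) = (\<Sum>d\<in>(?A \<union> ?B) \<union> ?C. d)"
    by (rule sum.cong) auto
  moreover have "(\<Sum>d\<in>(?A \<union> ?B) \<union> ?C. d) = (\<Sum>d\<in>?A. d) + (\<Sum>d\<in>?B. d) + (\<Sum>d\<in>?C. d)"
  proof -
    have "(?A \<union> ?B) \<inter> ?C = {}" "?A \<inter> ?B = {}" by auto
    then show ?thesis using fins by (simp only: sum.union_disjoint finite_UnI)
  qed
  ultimately show ?thesis by (simp add: sum.distrib)
qed

lemma dvd_sum_divisors:
  fixes n k :: nat
  assumes "0 < n" "\<And>t. t * t \<noteq> n" "\<And>d e. d * e = n \<Longrightarrow> k dvd d + e"
  shows "k dvd (\<Sum>d | d dvd n. d)"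
  using assms by (auto simp: sum_divisors_pairs intro!: dvd_sum)

text \<open>Complementary divisors of an odd number are both odd, so each pair has even sum and only
  a square root can change the parity.\<close>

lemma odd_sum_divisors_iff:
  fixes n :: nat
  assumes "odd n"
  shows "odd (\<Sum>d | d dvd n. d) \<longleftrightarrow> (\<exists>t. t * t = n)"
proof -
  have "even (\<Sum>d | d dvd n \<and> d * d < n. d + n div d)"
    using assms by (intro dvd_sum) (auto elim!: dvdE)
  moreover have "odd (\<Sum>d | d * d = n. d) \<longleftrightarrow> (\<exists>t. t * t = n)"
  proof (cases "\<exists>t. t * t = n")
    case True
    then obtain t where t: "t * t = n" by blast
    have "{d. d * d = n} = {t}"
      using t by (auto simp flip: power2_eq_square)
    then show ?thesis using t assms by auto
  qed auto
  ultimately show ?thesis using assms by (simp add: sum_divisors_pairs odd_pos)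
qed

section \<open>Divisor sums in residue classes\<close>

lemma mod_8_cases: "(a :: nat) mod 8 \<in> {0, 1, 2, 3, 4, 5, 6, 7}"
  by auto

lemma square_mod_8: "(t * t :: nat) mod 8 \<in> {0, 1, 4}"
  using mod_8_cases[of t] by (auto simp: mod_mult_eq[of t 8 t, symmetric])

lemma odd_square_mod_8: "odd (t :: nat) \<Longrightarrow> t * t mod 8 = 1"
proof -
  assume "odd t"
  then have "odd (t mod 8)" by (simp add: dvd_mod_iff)
  then have "t mod 8 \<in> {1, 3, 5, 7}" using mod_8_cases[of t] by (elim insertE emptyE) simp_all
  then show ?thesis by (auto simp: mod_mult_eq[of t 8 t, symmetric])
qed

text \<open>Units modulo 3, 4 and 8 are their own inverses, so d e = -1 forces e = -d; moreover -1
  is not a square there.\<close>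

lemma sum_divisors_mod:
  fixes n m :: nat
  assumes "m \<in> {3, 4, 8}" "n mod m = m - 1"
  shows "m dvd (\<Sum>d | d dvd n. d)"
proof (rule dvd_sum_divisors)
  \<comment> \<open>These two facts about residues are a finite check for each modulus.\<close>
  let ?P = "\<lambda>m::nat. (\<forall>r\<in>set [0..<m]. r * r mod m \<noteq> m - 1) \<and>
    (\<forall>r\<in>set [0..<m]. \<forall>s\<in>set [0..<m]. r * s mod m = m - 1 \<longrightarrow> (r + s) mod m = 0)"
  have "?P 3" "?P 4" "?P 8" by code_simp+
  then have P: "?P m" using assms(1) by auto
  have m: "d mod m \<in> set [0..<m]" for d using assms(1) by auto
  show "t * t \<noteq> n" for t
    using P m[of t] assms(2) by (metis mod_mult_eq)
  show "m dvd d + e" if "d * e = n" for d e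
    using P m[of d] m[of e] assms(2) that by (metis mod_add_eq mod_mult_eq dvd_eq_mod_eq_0)
  show "0 < n" using assms by (intro gr0I) auto
qed

text \<open>Both factors are odd, and an odd residue modulo 4 is its own inverse.\<close>

lemma factors_mod_4_eq:
  fixes d e :: nat
  assumes "d * e mod 4 = 1"
  shows "d mod 4 = e mod 4" "(d + e) mod 4 = 2"
proof -
  have *: "d mod 4 \<in> {0, 1, 2, 3}" for d :: nat by auto
  have "(d mod 4) * (e mod 4) mod 4 = 1" using assms by (simp add: mod_mult_eq)
  then have "d mod 4 = e mod 4 \<and> (d mod 4 + e mod 4) mod 4 = 2"
    using *[of d] *[of e] by (elim insertE emptyE) simp_all
  then show "d mod 4 = e mod 4" "(d + e) mod 4 = 2" by (simp_all only: mod_add_eq)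
qed

text \<open>Each complementary pair has sum 2 modulo 4, so only the number of pairs matters.\<close>

lemma sum_divisors_cong_card:
  fixes n :: nat
  assumes "n mod 4 = 1" "\<And>t. t * t \<noteq> n"
  shows "[(\<Sum>d | d dvd n. d) = 2 * card {d. d dvd n \<and> d * d < n}] (mod 4)"
proof -
  have "[d + n div d = 2] (mod 4)" if "d dvd n" for d
  proof -
    from that obtain e where e: "n = d * e" by blast
    have "(d + e) mod 4 = 2" using factors_mod_4_eq[of d e] assms(1) e by simp
    moreover have "0 < d" using assms(2)[of 0] e by (intro gr0I) auto
    ultimately show ?thesis using e by (simp add: cong_def)
  qed
  then have "[(\<Sum>d | d dvd n \<and> d * d < n. d + n div d) = (\<Sum>d | d dvd n \<and> d * d < n. 2)] (mod 4)"
    by (intro cong_sum) auto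
  moreover have "0 < n" using assms(2)[of 0] by (intro gr0I) auto
  ultimately show ?thesis using assms(2) by (simp add: sum_divisors_pairs mult.commute)
qed

text \<open>Zagier's involution on the solutions of \<open>x\<^sup>2 + 4yz = n\<close> has the fixed points \<open>x = y\<close>, which are
  the factorizations \<open>n = x(x + 4z)\<close>, while the swap of \<open>y\<close> and \<open>z\<close> has the fixed points \<open>y = z\<close>.\<close>

lemma zagier_parity:
  fixes n :: nat
  assumes n: "n mod 4 = 1" "\<And>t. t * t \<noteq> n"
  shows "even (card {d. d dvd n \<and> d * d < n}) \<longleftrightarrow>
    even (card {(x, y). x * x + 4 * (y * y) = n})"
proof -
  \<comment> \<open>Integer coordinates keep the subtractions in the involution from being truncated
    at 0.\<close>
  define X where "X = {(x, y, z). 0 < x \<and> 0 < y \<and> 0 < z \<and> x * x + 4 * (y * z) = int n}"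
  have nonsq: "t * t \<noteq> int n" for t
    using n(2)[of "nat \<bar>t\<bar>"] by (metis abs_ge_zero abs_mult_self_eq int_nat_eq of_nat_eq_iff of_nat_mult)
  have finX: "finite X"
  proof (rule finite_subset)
    show "X \<subseteq> {0..int n} \<times> {0..int n} \<times> {0..int n}"
    proof
      fix p assume "p \<in> X"
      then obtain x y z where xyz: "p = (x, y, z)"
        and p: "0 < x" "0 < y" "0 < z" and e: "x * x + 4 * (y * z) = int n"
        by (auto simp: X_def)
      have "x \<le> x * x" "y \<le> y * z" "z \<le> y * z" "0 < x * x" "0 < y * z"
        using p mult_left_mono[of 1 x x] mult_left_mono[of 1 z y] mult_right_mono[of 1 y z] by auto
      then show "p \<in> {0..int n} \<times> {0..int n} \<times> {0..int n}"
        using p e unfolding xyz mem_Sigma_iff atLeastAtMost_iff by (intro conjI; linarith)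
    qed
  qed auto
  define f where "f = (\<lambda>(x, y, z). if x + z < y then (x + 2 * z, z, y - x - z)
    else if x < 2 * y then (2 * y - x, y, x + z - y) else (x - 2 * y, x + z - y, y :: int))"
  \<comment> \<open>The borderlines between the cases of \<open>f\<close> contain no solutions: x +
    z = y makes n the square of y + z, and x = 2y makes n even.\<close>
  have generic: "x + z \<noteq> y" "x \<noteq> 2 * y" if "(x, y, z) \<in> X" for x y z
  proof -
    show "x + z \<noteq> y"
    proof
      assume "x + z = y"
      then have "(y + z) * (y + z) = int n" using that unfolding X_def by (auto simp: algebra_simps)
      then show False using nonsq by blast
    qed
    show "x \<noteq> 2 * y"
    proof
      assume "x = 2 * y"
      then have "int n = 2 * (2 * y * y + 2 * y * z)"
        using that unfolding X_def by (auto simp: algebra_simps)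
      then have "even (int n)" by (metis dvd_triv_left)
      then show False using n(1) by simp presburger
    qed
  qed
  have fX: "f p \<in> X" if "p \<in> X" for p
  proof -
    obtain x y z where p: "p = (x, y, z)" by (cases p)
    show ?thesis
      using generic[of x y z] that unfolding p f_def X_def by (auto simp: algebra_simps)
  qed
  have ff: "f (f p) = p" if "p \<in> X" for p
  proof -
    obtain x y z where p: "p = (x, y, z)" by (cases p)
    show ?thesis
      using generic[of x y z] that unfolding p f_def X_def by (auto simp: algebra_simps)
  qed
  \<comment> \<open>At a fixed point x = y = d, so n = d (d + 4z) and z is a quarter of the
    difference of complementary divisors.\<close>
  have fixf: "{p \<in> X. f p = p} = (\<lambda>d. (int d, int d, int ((n div d - d) div 4))) ` {d. d dvd n \<and> d * d < n}"
    (is "_ = ?g ` ?D")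
  proof (intro equalityI subsetI)
    fix p assume a: "p \<in> {p \<in> X. f p = p}"
    obtain x y z where p: "p = (x, y, z)" by (cases p)
    have pos: "0 < x" "0 < y" "0 < z" and e: "x * x + 4 * (y * z) = int n" and fp: "f (x, y, z) = (x, y, z)"
      using a unfolding p X_def by auto
    \<comment> \<open>The middle case gives this at once; the outer cases would force z = 0 or y =
      0.\<close>
    have "x = y"
    proof -
      consider "x + z < y" | "\<not> x + z < y" "x < 2 * y" | "\<not> x + z < y" "\<not> x < 2 * y" by blast
      then show ?thesis
      proof cases
        case 1
        then have "f (x, y, z) = (x + 2 * z, z, y - x - z)" by (simp add: f_def)
        then have "x + 2 * z = x" using fp by (simp only: prod.inject)
        with pos show ?thesis by linarith
      next
        case 2
        then have "f (x, y, z) = (2 * y - x, y, x + z - y)" by (simp add: f_def)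
        then have "2 * y - x = x" using fp by (simp only: prod.inject)
        then show ?thesis by linarith
      next
        case 3
        then have "f (x, y, z) = (x - 2 * y, x + z - y, y)" by (simp add: f_def)
        then have "x - 2 * y = x" using fp by (simp only: prod.inject)
        with pos show ?thesis by linarith
      qed
    qed
    with e have e: "x * x + 4 * (x * z) = int n" by simp
    define d k where "d = nat x" and "k = nat z"
    have dk: "x = int d" "z = int k" "0 < d" "0 < k" using pos by (auto simp: d_def k_def)
    have nd: "n = d * (d + 4 * k)"
    proof -
      have "int n = int (d * (d + 4 * k))" using e unfolding dk(1,2) by (simp add: algebra_simps)
      then show ?thesis by (simp only: of_nat_eq_iff)
    qed
    have "p = ?g d" using \<open>x = y\<close> dk nd by (simp add: p)
    moreover have "d \<in> ?D" using nd dk by auto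
    ultimately show "p \<in> ?g ` ?D" by (rule image_eqI)
  next
    fix p assume "p \<in> ?g ` ?D"
    then obtain d where d: "d dvd n" "d * d < n" "p = ?g d" by blast
    then obtain e where e: "n = d * e" by blast
    have "d mod 4 = e mod 4" using factors_mod_4_eq[of d e] n e by simp
    moreover have "d < e" using d e by simp
    ultimately have "4 dvd e - d" using mod_eq_dvd_iff_nat[of d e 4] by simp
    then obtain k where "e - d = 4 * k" by blast
    with \<open>d < e\<close> have k: "e = d + 4 * k" "0 < k" by auto
    have "0 < d" using n(1) e by (intro gr0I) auto
    then have "p = (int d, int d, int k)" using d(3) k e by simp
    then show "p \<in> {p \<in> X. f p = p}"
      using \<open>0 < d\<close> k e by (auto simp: X_def f_def algebra_simps)
  qed
  have "inj_on ?g ?D" by (auto simp: inj_on_def)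
  then have 1: "card {p \<in> X. f p = p} = card ?D" unfolding fixf by (rule card_image)
  let ?s = "\<lambda>(x, y, z). (x, z, y)"
  have fixs: "{p \<in> X. ?s p = p} = (\<lambda>(x, y). (int x, int y, int y)) ` {(x, y). x * x + 4 * (y * y) = n}"
    (is "_ = ?h ` ?E")
  proof (intro equalityI subsetI)
    fix p assume a: "p \<in> {p \<in> X. ?s p = p}"
    then obtain x y where p: "p = (x, y, y)" "0 < x" "0 < y" "x * x + 4 * (y * y) = int n"
      unfolding X_def by auto
    have "p = ?h (nat x, nat y)" using p by simp
    moreover have "int (nat x * nat x + 4 * (nat y * nat y)) = int n" using p by simp
    then have "(nat x, nat y) \<in> ?E" by (simp only: of_nat_eq_iff mem_Collect_eq prod.case)
    ultimately show "p \<in> ?h ` ?E" by (rule image_eqI)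
  next
    fix p assume "p \<in> ?h ` ?E"
    then obtain x y where p: "p = (int x, int y, int y)" "x * x + 4 * (y * y) = n" by auto
    have "int x * int x + 4 * (int y * int y) = int n" using p(2) by auto
    \<comment> \<open>x = 0 would make n divisible by 4, and y = 0 would make n a square.\<close>
    moreover have "0 < x" using p(2) n(1) by (intro gr0I) auto
    moreover have "0 < y" using p(2) n(2) by (intro gr0I) auto
    ultimately show "p \<in> {p \<in> X. ?s p = p}" using p(1) by (auto simp: X_def)
  qed
  have "inj_on ?h ?E" by (auto simp: inj_on_def)
  then have 2: "card {p \<in> X. ?s p = p} = card ?E" unfolding fixs by (rule card_image)
  have "even (card X) \<longleftrightarrow> even (card {p \<in> X. f p = p})"
    by (rule involution_card_mod_2) (use finX fX ff in auto)
  moreover have "even (card X) \<longleftrightarrow> even (card {p \<in> X. ?s p = p})"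
    by (rule involution_card_mod_2) (use finX in \<open>auto simp: X_def mult.commute\<close>)
  ultimately show ?thesis using 1 2 by simp
qed

section \<open>The recurrence for tuples of length 3\<close>

lemma fps_numeral_dvd_iff: "(numeral k :: int fps) dvd F \<longleftrightarrow> (\<forall>n. numeral k dvd F $ n)"
proof
  assume "\<forall>n. numeral k dvd F $ n"
  then have "F = numeral k * Abs_fps (\<lambda>n. F $ n div numeral k)"
    by (simp add: fps_eq_iff fps_numeral_mult_nth)
  then show "numeral k dvd F" by (rule dvdI)
qed (auto simp: fps_numeral_mult_nth)

text \<open>F(q)^2 and F(q^2) agree modulo 2: swapping \<open>i\<close> and \<open>n - i\<close>
  cancels all terms of the convolution except the diagonal one.\<close>

lemma fps_square_parity:
  fixes F :: "int fps"
  shows "even ((F * F) $ n - (if even n then F $ (n div 2) else 0))"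
proof -
  let ?g = "\<lambda>i. F $ i * F $ (n - i)"
  have "even (sum ?g {0..n}) \<longleftrightarrow> even (sum ?g {i \<in> {0..n}. n - i = i})"
    by (rule involution_sum_mod_2) (auto simp: mult.commute)
  moreover have "i \<le> n \<and> n - i = i \<longleftrightarrow> even n \<and> i = n div 2" for i by presburger
  then have "{i \<in> {0..n}. n - i = i} = (if even n then {n div 2} else {})" by auto
  moreover have "n - n div 2 = n div 2" if "even n" using that by (auto elim!: evenE)
  ultimately show ?thesis by (simp add: fps_mult_nth)
qed

section \<open>The substitution of -q for q\<close>

definition fps_flip :: "int fps \<Rightarrow> int fps" where
  "fps_flip F = Abs_fps (\<lambda>n. (- 1) ^ n * F $ n)"

lemma fps_flip_mult: "fps_flip (F * G) = fps_flip F * fps_flip G"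
proof -
  have "(- 1) ^ n * (F $ i * G $ (n - i)) = (- 1) ^ i * F $ i * ((- 1) ^ (n - i) * G $ (n - i))"
    if "i \<in> {0..n}" for i n
  proof -
    have "(- 1 :: int) ^ n = (- 1) ^ i * (- 1) ^ (n - i)"
      using that by (simp flip: power_add)
    then show ?thesis by simp
  qed
  then show ?thesis
    by (auto simp: fps_flip_def fps_eq_iff fps_mult_nth sum_distrib_left intro!: sum.cong)
qed

lemma fps_flip_X_deriv: "fps_X * fps_deriv (fps_flip F) = fps_flip (fps_X * fps_deriv F)"
  by (rule fps_ext) (simp only: fps_X_deriv_nth fps_flip_def fps_nth_Abs_fps mult.left_commute)

lemma fps_flip_odd_sigma_gf: "fps_flip odd_sigma_gf = - odd_sigma_gf"
  by (simp add: fps_eq_iff fps_flip_def odd_sigma_gf_def)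

text \<open>\<open>odd_sigma_gf\<close> has only odd exponents, so A(q) and A(-q) have opposite
  logarithmic derivatives. Their product is constant, hence A(0)^2 = 1.\<close>

lemma mult_flip_eq_1:
  assumes A: "fps_X * fps_deriv A = of_int c * odd_sigma_gf * A" and A0: "A $ 0 = 1"
  shows "A * fps_flip A = 1"
proof -
  have c: "fps_flip (of_int c) = of_int c"
    by (simp add: fps_eq_iff fps_flip_def flip: fps_of_int)
  have "fps_X * fps_deriv (fps_flip A) = of_int c * (- odd_sigma_gf) * fps_flip A"
    by (simp only: fps_flip_X_deriv A fps_flip_mult fps_flip_odd_sigma_gf c)
  then have "fps_X * fps_deriv (A * fps_flip A) = 0"
    using A by (simp add: algebra_simps)
  then have "fps_deriv (A * fps_flip A) = 0" by simp
  then have "A * fps_flip A = fps_const ((A * fps_flip A) $ 0)" by (rule fps_deriv_eq_0_iff[THEN iffD1])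
  then show ?thesis using A0 by (simp add: fps_flip_def)
qed

section \<open>The series for triples and its divisibility by 3 and 9\<close>

definition OPT3_gf :: "int fps" where
  "OPT3_gf = Abs_fps (\<lambda>n. int (OPT 3 n))"

lemma OPT3_gf_eq: "OPT3_gf = odd_overpartition_gf ^ 3"
  unfolding OPT3_gf_def by (rule OPT_gf)

lemma OPT3_gf_log_deriv: "fps_X * fps_deriv OPT3_gf = of_int 6 * odd_sigma_gf * OPT3_gf"
proof -
  let ?P = odd_overpartition_gf
  have "fps_X * fps_deriv (?P ^ 3) = 3 * ?P ^ 2 * (fps_X * fps_deriv ?P)"
    by (simp add: power3_eq_cube power2_eq_square algebra_simps)
  then show ?thesis
    unfolding OPT3_gf_eq odd_overpartition_gf_log_deriv
    by (simp add: power3_eq_cube power2_eq_square algebra_simps)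
qed

lemma OPT3_rec: "int n * OPT3_gf $ n = 6 * (\<Sum>i=0..n. odd_sigma_gf $ i * OPT3_gf $ (n - i))"
proof -
  have "int n * OPT3_gf $ n = (6 * (odd_sigma_gf * OPT3_gf)) $ n"
    using OPT3_gf_log_deriv by (metis fps_X_deriv_nth mult.assoc of_int_numeral)
  then show ?thesis by (simp only: fps_numeral_mult_nth) (simp only: fps_mult_nth)
qed

lemma OPT3_gf_0: "OPT3_gf $ 0 = 1"
proof -
  have "\<xi> = ({#}, {})" if "\<xi> \<in> overpartitions_in {m. odd m} 0" for \<xi>
  proof -
    have "p \<notin># fst \<xi>" for p
      using part_le_weight[of p \<xi>] that by (auto simp: overpartitions_in_def is_overpartition_def)
    then have "fst \<xi> = {#}" by blast
    then show ?thesis using that by (cases \<xi>) (simp add: overpartitions_in_def is_overpartition_def)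
  qed
  moreover have "({#}, {}) \<in> overpartitions_in {m. odd m} 0"
    by (simp add: overpartitions_in_def weight_def is_overpartition_def)
  ultimately have "overpartitions_in {m. odd m} 0 = {({#}, {})}" by blast
  then have "odd_overpartition_gf $ 0 = 1"
    by (simp add: odd_overpartition_gf_def overpartition_gf_def)
  then show ?thesis by (simp add: OPT3_gf_eq fps_power_zeroth)
qed

lemma coprime_3_int: "\<not> 3 dvd n \<Longrightarrow> coprime 3 (int n)"
  by (rule prime_imp_coprime) (simp_all, presburger)

lemma OPT3_mod_3:
  assumes "\<not> 3 dvd n"
  shows "3 dvd OPT3_gf $ n"
proof -
  have "3 dvd int n * OPT3_gf $ n" unfolding OPT3_rec by simp
  then show ?thesis using coprime_3_int[OF assms] by (simp add: coprime_dvd_mult_right_iff)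
qed

text \<open>The 6 in the recurrence gives one factor 3. Each summand gives another: if 3 does not
  divide n - i, from the coefficient at n - i; otherwise i is 2 modulo 3 and 3 divides
  sigma(i).\<close>

lemma OPT3_mod_9:
  assumes "n mod 3 = 2"
  shows "9 dvd OPT3_gf $ n"
proof -
  have "3 dvd (\<Sum>i=0..n. odd_sigma_gf $ i * OPT3_gf $ (n - i))"
  proof (rule dvd_sum)
    fix i assume i: "i \<in> {0..n}"
    show "3 dvd odd_sigma_gf $ i * OPT3_gf $ (n - i)"
    proof (cases "3 dvd n - i")
      case True
      then have "i mod 3 = 2" using i assms unfolding atLeastAtMost_iff by presburger
      then have "3 dvd (\<Sum>d | d dvd i. d)" using sum_divisors_mod[of 3 i] by simp
      then have "3 dvd int (\<Sum>d | d dvd i. d)" by presburger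
      then have "3 dvd odd_sigma_gf $ i"
        by (simp add: odd_sigma_gf_def del: of_nat_sum)
      then show ?thesis by simp
    qed (simp add: OPT3_mod_3)
  qed
  then obtain k where "(\<Sum>i=0..n. odd_sigma_gf $ i * OPT3_gf $ (n - i)) = 3 * k" by blast
  then have "int n * OPT3_gf $ n = 9 * (2 * k)" unfolding OPT3_rec by simp
  then have "9 dvd int n * OPT3_gf $ n" by (rule dvdI)
  moreover have "coprime (3 ^ 2) (int n)"
  proof -
    have "\<not> 3 dvd n" using assms by presburger
    from coprime_3_int[OF this] show ?thesis unfolding coprime_power_left_iff by simp
  qed
  ultimately show ?thesis by (simp add: coprime_dvd_mult_right_iff)
qed

section \<open>Congruences modulo powers of 2\<close>

definition theta :: "nat \<Rightarrow> int fps" where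
  "theta k = Abs_fps (\<lambda>n. if \<exists>t. odd t \<and> n = k * (t * t) then 1 else 0)"

text \<open>Homogeneity of degree \<open>r\<close> for the grading by exponents modulo 8; degrees
  add under multiplication, so products can be discarded by degree alone.\<close>

definition supported_mod_8 :: "nat \<Rightarrow> int fps \<Rightarrow> bool" where
  "supported_mod_8 r F \<longleftrightarrow> (\<forall>n. F $ n \<noteq> 0 \<longrightarrow> n mod 8 = r)"

lemma supported_mod_8_mult:
  assumes "supported_mod_8 r F" "supported_mod_8 s G"
  shows "supported_mod_8 ((r + s) mod 8) (F * G)"
  unfolding supported_mod_8_def
proof (intro allI impI)
  fix n assume "(F * G) $ n \<noteq> 0"
  then obtain i where "i \<le> n" "F $ i \<noteq> 0" "G $ (n - i) \<noteq> 0"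
    unfolding fps_mult_nth by (metis (no_types, lifting) atLeastAtMost_iff mult_eq_0_iff sum.neutral)
  with assms have "i mod 8 = r" "(n - i) mod 8 = s" by (auto simp: supported_mod_8_def)
  then have "(i + (n - i)) mod 8 = (r + s) mod 8" by (metis mod_add_eq)
  with \<open>i \<le> n\<close> show "n mod 8 = (r + s) mod 8" by simp
qed

lemma supported_mod_8_add:
  "supported_mod_8 r F \<Longrightarrow> supported_mod_8 r G \<Longrightarrow> supported_mod_8 r (F + G)"
  by (auto simp: supported_mod_8_def) (metis add.right_neutral)

text \<open>Odd squares are 1 modulo 8, which is why \<open>theta\<close> runs over odd
  \<open>t\<close> only.\<close>

lemma supported_mod_8_theta: "supported_mod_8 (k mod 8) (theta k)"
proof -
  have "k * (t * t) mod 8 = k mod 8" if "odd t" for t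
    using odd_square_mod_8[OF that] by (metis mod_mult_right_eq mult.right_neutral)
  then show ?thesis by (auto simp: supported_mod_8_def theta_def split: if_splits)
qed

text \<open>Modulo 2, squaring amounts to substituting q^2 for q, and this turns
  \<open>theta 1\<close> into \<open>theta 2\<close>.\<close>

lemma theta_square:
  obtains y where "theta 1 * theta 1 = theta 2 + 2 * y"
proof -
  have "even ((theta 1 * theta 1 - theta 2) $ n)" for n
  proof -
    have "theta 2 $ n = (if even n then theta 1 $ (n div 2) else 0)"
    proof (cases "even n")
      case True
      then obtain m where "n = 2 * m" by blast
      then show ?thesis by (simp add: theta_def)
    qed (auto simp: theta_def)
    then show ?thesis using fps_square_parity[of "theta 1" n] by simp
  qed
  then have "2 dvd theta 1 * theta 1 - theta 2" unfolding fps_numeral_dvd_iff by blast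
  then obtain y where "theta 1 * theta 1 - theta 2 = 2 * y" by blast
  then have "theta 1 * theta 1 = theta 2 + 2 * y" by (simp add: algebra_simps)
  then show ?thesis by (rule that)
qed

text \<open>A sum x^2 + 4 y^2 that is 5 modulo 8 has \<open>x\<close> and \<open>y\<close> odd, so
  the restriction to odd arguments in \<open>theta\<close> loses nothing.\<close>

lemma theta_mult_nth:
  assumes "n mod 8 = 5"
  shows "(theta 1 * theta 4) $ n = int (card {(x, y). x * x + 4 * (y * y) = n})"
proof -
  let ?E = "{(x, y). x * x + 4 * (y * y) = n}" and ?sq = "\<lambda>k i. \<exists>t. odd t \<and> i = k * (t * t)"
  have odds: "odd x \<and> odd y" if "(x, y) \<in> ?E" for x y
  proof -
    have e: "x * x + 4 * (y * y) = n" using that by simp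
    have "odd x" using e assms by (metis even_add even_mult_iff even_numeral mod_exhaust_less_4 dvd_mod_iff odd_numeral)
    moreover have "odd y"
    proof
      assume "even y"
      then obtain k where "y = 2 * k" by blast
      then have "n = x * x + 8 * (2 * (k * k))" using e by (simp add: algebra_simps)
      then have "n mod 8 = x * x mod 8" by (simp only: mod_mult_self2)
      then show False using square_mod_8[of x] assms by auto
    qed
    ultimately show ?thesis by simp
  qed
  \<comment> \<open>Sending (x, y) to x^2 matches the representations with the nonzero terms of the
    convolution.\<close>
  have "bij_betw (\<lambda>(x, y). x * x) ?E {i \<in> {0..n}. ?sq 1 i \<and> ?sq 4 (n - i)}"
    unfolding bij_betw_def
  proof (intro conjI equalityI subsetI)
    show "inj_on (\<lambda>(x, y). x * x) ?E"
      by (auto simp: inj_on_def simp flip: power2_eq_square)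
  next
    fix i assume "i \<in> (\<lambda>(x, y). x * x) ` ?E"
    then obtain x y where "i = x * x" "(x, y) \<in> ?E" by auto
    then show "i \<in> {i \<in> {0..n}. ?sq 1 i \<and> ?sq 4 (n - i)}" using odds[of x y] by auto
  next
    fix i assume "i \<in> {i \<in> {0..n}. ?sq 1 i \<and> ?sq 4 (n - i)}"
    then obtain x y where "i = x * x" "n - i = 4 * (y * y)" "i \<le> n" by auto
    then have "i = (\<lambda>(x, y). x * x) (x, y)" "(x, y) \<in> ?E" by auto
    then show "i \<in> (\<lambda>(x, y). x * x) ` ?E" by (rule image_eqI)
  qed
  then have "card ?E = card {i \<in> {0..n}. ?sq 1 i \<and> ?sq 4 (n - i)}" by (rule bij_betw_same_card)
  moreover have "(theta 1 * theta 4) $ n = (\<Sum>i\<in>{0..n}. if ?sq 1 i \<and> ?sq 4 (n - i) then 1 else 0)"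
    unfolding fps_mult_nth by (intro sum.cong refl) (simp add: theta_def)
  moreover have "\<dots> = (\<Sum>i\<in>{i \<in> {0..n}. ?sq 1 i \<and> ?sq 4 (n - i)}. 1)"
    by (rule sum.inter_filter[symmetric]) simp
  ultimately show ?thesis by simp
qed

section \<open>The divisor sum series modulo 2 and 4\<close>

lemma odd_sigma_gf_parity: "even (odd_sigma_gf $ n - theta 1 $ n)"
proof (cases "odd n")
  case True
  have "odd t" if "t * t = n" for t using that True by auto
  then have "(\<exists>t. odd t \<and> n = 1 * (t * t)) \<longleftrightarrow> odd (\<Sum>d | d dvd n. d)"
    unfolding odd_sum_divisors_iff[OF True] by auto
  then have "theta 1 $ n = (if odd (\<Sum>d | d dvd n. d) then 1 else 0)"
    unfolding theta_def by simp
  moreover have "odd_sigma_gf $ n = int (\<Sum>d | d dvd n. d)"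
    using True by (simp add: odd_sigma_gf_def)
  ultimately show ?thesis by (simp del: of_nat_sum)
qed (auto simp: odd_sigma_gf_def theta_def)

text \<open>\<open>s\<close> is the part in exponents 1 modulo 8, Zagier's involution supplies the
  exponents 5 modulo 8, and 4 divides sigma(n) for n = 3 modulo 4.\<close>

lemma odd_sigma_gf_mod_4:
  obtains s z where "supported_mod_8 1 s" "2 dvd s - theta 1"
    and "odd_sigma_gf = s + 2 * (theta 1 * theta 4) + 4 * z"
proof -
  let ?S = odd_sigma_gf
  define s where "s = Abs_fps (\<lambda>n. if n mod 8 = 1 then ?S $ n else 0)"
  have supp: "supported_mod_8 1 (theta 1)" "supported_mod_8 5 (theta 1 * theta 4)"
    using supported_mod_8_theta[of 1]
      supported_mod_8_mult[OF supported_mod_8_theta[of 1] supported_mod_8_theta[of 4]] by simp_all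
  have "supported_mod_8 1 s" by (simp add: supported_mod_8_def s_def)
  moreover have "2 dvd s - theta 1"
    unfolding fps_numeral_dvd_iff
  proof
    fix n :: nat
    show "even ((s - theta 1) $ n)"
    proof (cases "n mod 8 = 1")
      case True
      then show ?thesis using odd_sigma_gf_parity[of n] by (simp add: s_def)
    next
      case False
      then have "theta 1 $ n = 0" using supp(1) unfolding supported_mod_8_def by blast
      with False show ?thesis by (simp add: s_def)
    qed
  qed
  moreover have "4 dvd ?S - s - 2 * (theta 1 * theta 4)"
    unfolding fps_numeral_dvd_iff
  proof
    fix n :: nat
    let ?\<sigma> = "\<Sum>d | d dvd n. d"
    have int4: "4 dvd int m" if "4 dvd m" for m using that by presburger
    have "n mod 8 = 1 \<or> n mod 8 = 5 \<or> n mod 4 = 3 \<or> even n" by presburger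
    then consider "n mod 8 = 1" | "n mod 8 = 5" | "n mod 4 = 3" | "even n" by blast
    then have "4 dvd ?S $ n - s $ n - 2 * (theta 1 * theta 4) $ n"
    proof cases
      case 1
      then have "(theta 1 * theta 4) $ n = 0" using supp(2) by (auto simp: supported_mod_8_def)
      with 1 show ?thesis by (simp add: s_def)
    next
      case 2
      have n: "n mod 4 = 1" "odd n" using 2 by presburger+
      have nonsq: "t * t \<noteq> n" for t using square_mod_8[of t] 2 by auto
      let ?D = "{d. d dvd n \<and> d * d < n}" and ?E = "{(x, y). x * x + 4 * (y * y) = n}"
      \<comment> \<open>Modulo 4, sigma(n) is twice the number of divisor pairs, which has the
        parity of the number of representations as x^2 + 4 y^2.\<close>
      have "[?\<sigma> = 2 * card ?D] (mod 4)" using sum_divisors_cong_card n nonsq by blast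
      then have "4 dvd int ?\<sigma> - 2 * int (card ?D)"
        by (simp add: cong_iff_dvd_diff flip: cong_int_iff)
      moreover have "even (int (card ?D) - int (card ?E))"
        using zagier_parity[of n] n nonsq by simp
      ultimately have "4 dvd int ?\<sigma> - 2 * int (card ?E)" by presburger
      with 2 n show ?thesis by (simp add: s_def theta_mult_nth odd_sigma_gf_def del: of_nat_sum One_nat_def)
    next
      case 3
      then have "n mod 8 \<noteq> 1" "n mod 8 \<noteq> 5" "odd n" by presburger+
      moreover have "4 dvd int ?\<sigma>" using sum_divisors_mod[of 4 n] 3 by (intro int4) simp
      moreover have "(theta 1 * theta 4) $ n = 0" using supp(2) \<open>n mod 8 \<noteq> 5\<close> by (auto simp: supported_mod_8_def)
      ultimately show ?thesis by (simp add: s_def odd_sigma_gf_def del: of_nat_sum)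
    next
      case 4
      then have "n mod 8 \<noteq> 1" "n mod 8 \<noteq> 5" by presburger+
      moreover have "(theta 1 * theta 4) $ n = 0" using supp(2) \<open>n mod 8 \<noteq> 5\<close> by (auto simp: supported_mod_8_def)
      ultimately show ?thesis using 4 by (simp add: s_def odd_sigma_gf_def)
    qed
    then show "4 dvd (?S - s - 2 * (theta 1 * theta 4)) $ n" by (simp add: fps_numeral_mult_nth)
  qed
  then obtain z where "?S - s - 2 * (theta 1 * theta 4) = 4 * z" by blast
  then have "?S = s + 2 * (theta 1 * theta 4) + 4 * z" by (simp add: algebra_simps)
  ultimately show ?thesis by (rule that)
qed

text \<open>Modulo 4 and in exponents congruent to 7 modulo 8, both \<open>S o\<^sup>2\<close> and \<open>S e\<^sup>2\<close> reduce to
  \<open>2 \<theta>(q) \<theta>(q\<^sup>2) \<theta>(q\<^sup>4)\<close>.\<close>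

lemma odd_sigma_gf_mult_diff_squares:
  assumes o: "2 dvd od - theta 1" and e: "2 dvd ev - (theta 2 + theta 4 + g)"
    and g: "supported_mod_8 0 g" and n: "n mod 8 = 7"
  shows "4 dvd (odd_sigma_gf * (od * od - ev * ev)) $ n"
proof -
  let ?T1 = "theta 1" and ?T2 = "theta 2" and ?T4 = "theta 4"
  obtain s z where s: "supported_mod_8 1 s" "2 dvd s - ?T1"
    and S: "odd_sigma_gf = s + 2 * (?T1 * ?T4) + 4 * z"
    using odd_sigma_gf_mod_4 by blast
  obtain w where "s - ?T1 = 2 * w" using s(2) by blast
  then have w: "s = ?T1 + 2 * w" by (simp add: algebra_simps)
  obtain u where "od - ?T1 = 2 * u" using o by blast
  then have u: "od = ?T1 + 2 * u" by (simp add: algebra_simps)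
  obtain v where "ev - (?T2 + ?T4 + g) = 2 * v" using e by blast
  then have v: "ev = ?T2 + ?T4 + g + 2 * v" by (simp add: algebra_simps)
  obtain y where y: "?T1 * ?T1 = ?T2 + 2 * y" using theta_square by blast
  define Q where "Q = ?T4 * ?T4 + g * g"
  have T: "supported_mod_8 1 ?T1" "supported_mod_8 2 ?T2" "supported_mod_8 4 ?T4"
    using supported_mod_8_theta[of 1] supported_mod_8_theta[of 2] supported_mod_8_theta[of 4] by simp_all
  have "supported_mod_8 0 Q"
    using supported_mod_8_add[OF supported_mod_8_mult[OF T(3) T(3), simplified]
        supported_mod_8_mult[OF g g, simplified]] by (simp add: Q_def)
  note sm = supported_mod_8_mult
  have zero: "F $ n = 0" if "supported_mod_8 r F" "r \<noteq> 7" for F r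
    using that n by (auto simp: supported_mod_8_def)
  \<comment> \<open>The seven products have degrees 3, 5, 1, 3, 5, 1 and 5 modulo 8, whereas
    \<open>n\<close> is 7 modulo 8.\<close>
  have z1: "(s * (?T1 * ?T1)) $ n = 0" by (rule zero[OF sm[OF s(1) sm[OF T(1) T(1)]]]) simp
  have z2: "(s * (?T2 * ?T2)) $ n = 0" by (rule zero[OF sm[OF s(1) sm[OF T(2) T(2)]]]) simp
  have z3: "(s * Q) $ n = 0" by (rule zero[OF sm[OF s(1) \<open>supported_mod_8 0 Q\<close>]]) simp
  have z4: "(s * (?T2 * g)) $ n = 0" by (rule zero[OF sm[OF s(1) sm[OF T(2) g]]]) simp
  have z5: "(s * (?T4 * g)) $ n = 0" by (rule zero[OF sm[OF s(1) sm[OF T(3) g]]]) simp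
  have z6: "((?T1 * ?T4) * (?T2 * ?T2)) $ n = 0"
    by (rule zero[OF sm[OF sm[OF T(1) T(3)] sm[OF T(2) T(2)]]]) simp
  have z7: "((?T1 * ?T4) * Q) $ n = 0"
    by (rule zero[OF sm[OF sm[OF T(1) T(3)] \<open>supported_mod_8 0 Q\<close>]]) simp
  \<comment> \<open>\<open>V\<close> and \<open>M\<close> collect the errors of approximating
    \<open>od\<close>, \<open>ev\<close> and \<open>odd_sigma_gf\<close>; squaring turns errors
    divisible by 2 into errors divisible by 4.\<close>
  define V M where "V = ?T1 * u + u * u - (?T2 + ?T4 + g) * v - v * v"
    and "M = z * (od * od - ev * ev)"
  have X: "odd_sigma_gf * (od * od - ev * ev) = (s + 2 * (?T1 * ?T4)) * (od * od - ev * ev) + 4 * M"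
    unfolding S M_def by (simp add: algebra_simps)
  have D: "od * od - ev * ev = ?T1 * ?T1 - (?T2 + ?T4 + g) * (?T2 + ?T4 + g) + 4 * V"
    unfolding u v V_def by (simp add: algebra_simps)
  have "odd_sigma_gf * (od * od - ev * ev) =
      (s + 2 * (?T1 * ?T4)) * (?T1 * ?T1 - (?T2 + ?T4 + g) * (?T2 + ?T4 + g) + 4 * V) + 4 * M"
    by (subst X) (simp only: D)
  also have "\<dots> =
      s * (?T1 * ?T1) - s * (?T2 * ?T2) - s * Q
      - 2 * (s * (?T2 * g)) - 2 * (s * (?T4 * g)) - 2 * ((?T1 * ?T4) * (?T2 * ?T2)) - 2 * ((?T1 * ?T4) * Q)
      + 4 * (M + (s + 2 * (?T1 * ?T4)) * V - (?T1 * ?T4) * (?T2 * ?T4 + ?T2 * g + ?T4 * g))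
      + (2 * ((?T1 * ?T4) * (?T1 * ?T1)) - 2 * (s * (?T2 * ?T4)))"
    unfolding Q_def by (simp add: algebra_simps)
  \<comment> \<open>The two products of degree 7 that remain. They agree modulo 4, since modulo 2
    \<open>?T1 * ?T1\<close> is \<open>?T2\<close> and \<open>s\<close> is
    \<open>?T1\<close>.\<close>
  also have "2 * ((?T1 * ?T4) * (?T1 * ?T1)) - 2 * (s * (?T2 * ?T4)) = 4 * (?T1 * ?T4 * y - w * ?T2 * ?T4)"
    unfolding y w by (simp add: algebra_simps)
  finally show ?thesis
    by (simp only: fps_add_nth fps_sub_nth fps_numeral_mult_nth z1 z2 z3 z4 z5 z6 z7) simp
qed

text \<open>The recurrence \<open>OPT3_rec\<close> and the relation \<open>A(q) A(-q) = 1\<close>, written for \<open>A = 1 + 2 (e + o)\<close>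
  with even part \<open>e\<close> and odd part \<open>o\<close>.\<close>

lemma OPT3_even_odd_parts:
  obtains ev od where "OPT3_gf = 1 + 2 * (ev + od)"
    and "\<And>n. odd n \<Longrightarrow> ev $ n = 0" "\<And>n. even n \<Longrightarrow> od $ n = 0"
    and "ev = od * od - ev * ev"
    and "\<And>n. odd n \<Longrightarrow> int n * od $ n = 3 * odd_sigma_gf $ n + 6 * (odd_sigma_gf * ev) $ n"
proof -
  have "2 dvd odd_overpartition_gf - 1"
    unfolding fps_numeral_dvd_iff using odd_overpartition_gf_mod_2 by simp
  then obtain G where "odd_overpartition_gf - 1 = 2 * G" by blast
  then have G: "odd_overpartition_gf = 1 + 2 * G" by (simp add: algebra_simps)
  \<comment> \<open>\<open>H\<close> is ((1 + 2 G)^3 - 1)/2.\<close>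
  define H where "H = 3 * G + 6 * (G * G) + 4 * (G * G * G)"
  have H: "OPT3_gf = 1 + 2 * H"
    unfolding OPT3_gf_eq G H_def by (simp add: power3_eq_cube algebra_simps)
  define ev where "ev = Abs_fps (\<lambda>n. if even n then H $ n else 0)"
  define od where "od = Abs_fps (\<lambda>n. if odd n then H $ n else 0)"
  have Heo: "H = ev + od" by (simp add: fps_eq_iff ev_def od_def)
  have "fps_flip OPT3_gf = 1 + 2 * (ev - od)"
    unfolding H by (auto simp: fps_eq_iff fps_flip_def ev_def od_def fps_numeral_mult_nth)
  moreover have "OPT3_gf * fps_flip OPT3_gf = 1"
    by (rule mult_flip_eq_1[OF OPT3_gf_log_deriv OPT3_gf_0])
  ultimately have "(1 + 2 * (ev + od)) * (1 + 2 * (ev - od)) = 1"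
    unfolding H Heo by simp
  \<comment> \<open>The product equals (1 + 2 ev)^2 - 4 od^2.\<close>
  then have "4 * (ev + ev * ev - od * od) = 0" by (simp add: algebra_simps)
  then have "ev + ev * ev - od * od = 0" by (simp only: mult_eq_0_iff) simp
  then have rel: "ev = od * od - ev * ev" by (simp add: algebra_simps)
  have "int n * od $ n = 3 * odd_sigma_gf $ n + 6 * (odd_sigma_gf * ev) $ n" if n: "odd n" for n
  proof -
    \<comment> \<open>Both factors live on odd exponents, so their product lives on even
      ones.\<close>
    have "(odd_sigma_gf * od) $ n = 0"
      unfolding fps_mult_nth
    proof (rule sum.neutral, rule ballI)
      fix i assume "i \<in> {0..n}"
      then show "odd_sigma_gf $ i * od $ (n - i) = 0"
        using n by (auto simp: odd_sigma_gf_def od_def)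
    qed
    moreover have "int n * OPT3_gf $ n = (6 * (odd_sigma_gf * OPT3_gf)) $ n"
      using OPT3_gf_log_deriv by (metis fps_X_deriv_nth mult.assoc of_int_numeral)
    moreover have "6 * (odd_sigma_gf * OPT3_gf) =
        6 * odd_sigma_gf + 12 * (odd_sigma_gf * ev) + 12 * (odd_sigma_gf * od)"
      unfolding H Heo by (simp add: algebra_simps)
    moreover have "OPT3_gf $ n = 2 * od $ n"
      unfolding H using n by (simp add: od_def fps_numeral_mult_nth odd_pos)
    ultimately show ?thesis by (simp add: fps_numeral_mult_nth)
  qed
  moreover have "\<And>n. odd n \<Longrightarrow> ev $ n = 0" "\<And>n. even n \<Longrightarrow> od $ n = 0"
    by (simp_all add: ev_def od_def)
  ultimately show ?thesis using that[of ev od] H rel unfolding Heo by blast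
qed

lemma theta_1_nonsquare: "(\<And>t. t * t \<noteq> n) \<Longrightarrow> theta 1 $ n = 0"
  by (auto simp: theta_def)

text \<open>Everything is read off from \<open>ev\<close> and \<open>od\<close>: modulo 2,
  \<open>od\<close> is \<open>theta 1\<close>, and halving exponents reduces \<open>ev\<close> to
  \<open>od\<close>. For 16, the recurrence makes the coefficient of \<open>od\<close> divisible by
  8.\<close>

lemma OPT3_mod_powers_of_2:
  shows OPT3_mod_2: "0 < n \<Longrightarrow> 2 dvd OPT3_gf $ n"
    and OPT3_mod_4_odd: "odd n \<Longrightarrow> (\<And>t. t * t \<noteq> n) \<Longrightarrow> 4 dvd OPT3_gf $ n"
    and OPT3_mod_4_even: "odd n \<Longrightarrow> (\<And>t. t * t \<noteq> n) \<Longrightarrow> 4 dvd OPT3_gf $ (2 * n)"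
    and OPT3_mod_16: "n mod 8 = 7 \<Longrightarrow> 16 dvd OPT3_gf $ n"
proof -
  obtain ev od where A: "OPT3_gf = 1 + 2 * (ev + od)"
    and ev0: "\<And>n. odd n \<Longrightarrow> ev $ n = 0" and od0: "\<And>n. even n \<Longrightarrow> od $ n = 0"
    and rel: "ev = od * od - ev * ev"
    and rec: "\<And>n. odd n \<Longrightarrow> int n * od $ n = 3 * odd_sigma_gf $ n + 6 * (odd_sigma_gf * ev) $ n"
    using OPT3_even_odd_parts by metis
  have A_nth: "OPT3_gf $ n = 2 * (ev $ n + od $ n)" if "0 < n" for n
    unfolding A using that by (simp add: fps_numeral_mult_nth)
  have od_theta: "even (od $ n - theta 1 $ n)" for n
  proof (cases "odd n")
    case True
    have "int n * od $ n = odd_sigma_gf $ n + 2 * (odd_sigma_gf $ n + 3 * (odd_sigma_gf * ev) $ n)"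
      using rec[OF True] by simp
    then have "even (int n * od $ n) \<longleftrightarrow> even (odd_sigma_gf $ n)" by simp
    then have "even (od $ n - odd_sigma_gf $ n)" using True by simp
    then show ?thesis using odd_sigma_gf_parity[of n] by presburger
  next
    case False
    then show ?thesis using od0[of n] by (auto simp: theta_def)
  qed
  \<comment> \<open>Modulo 2 the relation for \<open>ev\<close> becomes ev(q) = od(q^2) +
    ev(q^2).\<close>
  have ev_half: "even (ev $ (2 * k) - (od $ k + ev $ k))" for k
  proof -
    have "ev $ (2 * k) = (od * od) $ (2 * k) - (ev * ev) $ (2 * k)"
      by (subst rel) simp
    then show ?thesis
      using fps_square_parity[of od "2 * k"] fps_square_parity[of ev "2 * k"] by simp
  qed
  show "2 dvd OPT3_gf $ n" if "0 < n" using A_nth[OF that] by simp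
  have od_even: "even (od $ n)" if "\<And>t. t * t \<noteq> n" for n
    using od_theta[of n] theta_1_nonsquare[OF that] by simp
  show "4 dvd OPT3_gf $ n" if "odd n" "\<And>t. t * t \<noteq> n"
  proof -
    have "OPT3_gf $ n = 2 * od $ n" using A_nth[of n] ev0[of n] that(1) by (simp add: odd_pos)
    then show ?thesis using od_even[OF that(2)] by presburger
  qed
  show "4 dvd OPT3_gf $ (2 * n)" if "odd n" "\<And>t. t * t \<noteq> n"
  proof -
    have "OPT3_gf $ (2 * n) = 2 * ev $ (2 * n)"
      using A_nth[of "2 * n"] od0[of "2 * n"] that(1) by (simp add: odd_pos)
    moreover have "even (ev $ (2 * n))"
      using ev_half[of n] ev0[of n] that(1) od_even[OF that(2)] by simp
    ultimately show ?thesis by presburger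
  qed
  show "16 dvd OPT3_gf $ n" if n: "n mod 8 = 7"
  proof -
    have n_odd: "odd n" using n by presburger
    define g where "g = Abs_fps (\<lambda>n. if n mod 8 = 0 then ev $ n else 0)"
    have g: "supported_mod_8 0 g" by (simp add: g_def supported_mod_8_def)
    \<comment> \<open>Exponents 2 modulo 4 become odd after one halving, and exponents 4 modulo 8
      after two; multiples of 8 are left in \<open>g\<close>, of which only the degree
      matters.\<close>
    have "2 dvd ev - (theta 2 + theta 4 + g)"
      unfolding fps_numeral_dvd_iff
    proof
      fix m :: nat
      have th: "theta k $ m = 0" if "m mod 8 \<noteq> k mod 8" for k
        using supported_mod_8_theta[of k] that unfolding supported_mod_8_def by blast
      have dbl: "theta (2 * k) $ (2 * m) = theta k $ m" for k m by (simp add: theta_def)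
      have "odd m \<or> m mod 8 = 0 \<or> m mod 8 = 4 \<or> m mod 4 = 2" by presburger
      then consider "odd m" | "m mod 8 = 0" | "m mod 8 = 4" | "m mod 4 = 2" by fast
      then have "even (ev $ m - (theta 2 $ m + theta 4 $ m + g $ m))"
      proof cases
        case 1
        then have "m mod 8 \<noteq> 2" "m mod 8 \<noteq> 4" "m mod 8 \<noteq> 0" by presburger+
        then show ?thesis using th[of 2] th[of 4] ev0[OF 1] by (simp add: g_def)
      next
        case 2
        then show ?thesis using th[of 2] th[of 4] by (simp add: g_def)
      next
        case 3
        then have "m = 2 * (2 * (m div 4)) \<and> odd (m div 4)" by presburger
        then obtain k where k: "m = 2 * (2 * k)" and "odd k" by blast
        have "theta 4 $ m = theta 1 $ k" using dbl[of 2 "2 * k"] dbl[of 1 k] k by simp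
        moreover have "even (ev $ m - theta 1 $ k)"
          using ev_half[of "2 * k"] ev_half[of k] od0[of "2 * k"] ev0[OF \<open>odd k\<close>] od_theta[of k] k
          by simp
        ultimately show ?thesis using 3 th[of 2] by (simp add: g_def)
      next
        case 4
        then have "m mod 8 \<noteq> 4" "m mod 8 \<noteq> 0" by presburger+
        have "m = 2 * (m div 2) \<and> odd (m div 2)" using 4 by presburger
        then obtain k where k: "m = 2 * k" and "odd k" by blast
        have "theta 2 $ m = theta 1 $ k" using dbl[of 1 k] k by simp
        moreover have "even (ev $ m - theta 1 $ k)"
          using ev_half[of k] ev0[OF \<open>odd k\<close>] od_theta[of k] k by simp
        ultimately show ?thesis using \<open>m mod 8 \<noteq> 4\<close> \<open>m mod 8 \<noteq> 0\<close> th[of 4] by (simp add: g_def)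
      qed
      then show "2 dvd (ev - (theta 2 + theta 4 + g)) $ m" by simp
    qed
    moreover have "2 dvd od - theta 1" unfolding fps_numeral_dvd_iff using od_theta by simp
    ultimately have "4 dvd (odd_sigma_gf * ev) $ n"
      using odd_sigma_gf_mult_diff_squares[of od ev g n] g n rel by simp
    moreover have "8 dvd odd_sigma_gf $ n"
    proof -
      have "8 dvd (\<Sum>d | d dvd n. d)" using sum_divisors_mod[of 8 n] n by simp
      then have "8 dvd int (\<Sum>d | d dvd n. d)" by presburger
      then show ?thesis by (simp add: odd_sigma_gf_def del: of_nat_sum)
    qed
    \<comment> \<open>The first term contains sigma(n), a multiple of 8; the second is 6 times a
      multiple of 4.\<close>
    ultimately have "8 dvd 3 * odd_sigma_gf $ n + 6 * (odd_sigma_gf * ev) $ n" by presburger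
    then have "8 dvd int n * od $ n" using rec[OF n_odd] by simp
    moreover have "coprime (2 ^ 3) (int n)" using n_odd unfolding coprime_power_left_iff by simp
    ultimately have "8 dvd od $ n" by (simp add: coprime_dvd_mult_right_iff)
    moreover have "OPT3_gf $ n = 2 * od $ n" using A_nth[of n] ev0[OF n_odd] n_odd by (simp add: odd_pos)
    ultimately show ?thesis by presburger
  qed
qed

section \<open>Nonsquares and the combination of the prime powers\<close>

lemma not_square_mod_3: "n mod 3 = 2 \<Longrightarrow> t * t \<noteq> n" for n t :: nat
proof -
  assume n: "n mod 3 = 2"
  have "t mod 3 = 0 \<or> t mod 3 = 1 \<or> t mod 3 = 2" by auto
  then have "t * t mod 3 \<noteq> 2" by (auto simp: mod_mult_eq[of t 3 t, symmetric])
  with n show ?thesis by auto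
qed

lemma not_square_mod_4: "n mod 4 = 3 \<Longrightarrow> t * t \<noteq> n" for n t :: nat
proof -
  assume "n mod 4 = 3"
  then have "n mod 8 = 3 \<or> n mod 8 = 7" by presburger
  then show ?thesis using square_mod_8[of t] by auto
qed

lemma OPT_3_cong_0_iff: "[OPT 3 n = 0] (mod numeral k) \<longleftrightarrow> numeral k dvd OPT3_gf $ n"
proof -
  have "numeral k dvd int (OPT 3 n) \<longleftrightarrow> numeral k dvd OPT 3 n"
    by (metis int_dvd_int_iff of_nat_numeral)
  then show ?thesis by (simp add: OPT3_gf_def cong_0_iff)
qed

theorem theorem1p2:
  fixes n :: nat
  shows "[OPT 3 (3 * n + 1) = 0] (mod 6) \<and>
         [OPT 3 (12 * n + 7) = 0] (mod 12) \<and>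
         [OPT 3 (12 * n + 10) = 0] (mod 12) \<and>
         [OPT 3 (3 * n + 2) = 0] (mod 18) \<and>
         [OPT 3 (6 * n + 5) = 0] (mod 36) \<and>
         [OPT 3 (24 * n + 23) = 0] (mod 144)"
  unfolding OPT_3_cong_0_iff
proof (intro conjI)
  have comb: "a * b dvd x" if "a dvd x" "b dvd x" "coprime a b" for a b x :: int
    using that by (rule divides_mult)
  have c: "coprime (2 :: int) 3" "coprime (4 :: int) 3" "coprime (2 :: int) 9" "coprime (4 :: int) 9"
    "coprime (16 :: int) 9"
    by (simp_all add: coprime_iff_gcd_eq_1 gcd_non_0_int)
  have nd3: "\<not> 3 dvd 3 * n + 1" "\<not> 3 dvd 12 * n + 7" "\<not> 3 dvd 12 * n + 10" by presburger+
  have r: "(3 * n + 2) mod 3 = 2" "(6 * n + 5) mod 3 = 2" "(24 * n + 23) mod 3 = 2"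
    "(12 * n + 7) mod 4 = 3" "(24 * n + 23) mod 8 = 7" "odd (6 * n + 5)" "odd (12 * n + 7)"
    by presburger+
  show "6 dvd OPT3_gf $ (3 * n + 1)"
    using comb[OF OPT3_mod_2 OPT3_mod_3[OF nd3(1)] c(1)] by simp
  show "12 dvd OPT3_gf $ (12 * n + 7)"
    using comb[OF OPT3_mod_4_odd[OF r(7) not_square_mod_4[OF r(4)]] OPT3_mod_3[OF nd3(2)] c(2)] by simp
  \<comment> \<open>Twice an odd number that is 2 modulo 3 and hence not a square.\<close>
  have "2 * (6 * n + 5) = 12 * n + 10" by simp
  then show "12 dvd OPT3_gf $ (12 * n + 10)"
    using comb[OF OPT3_mod_4_even[OF r(6) not_square_mod_3[OF r(2)]] _ c(2)] OPT3_mod_3[OF nd3(3)] by simp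
  show "18 dvd OPT3_gf $ (3 * n + 2)"
    using comb[OF OPT3_mod_2 OPT3_mod_9[OF r(1)] c(3)] by simp
  show "36 dvd OPT3_gf $ (6 * n + 5)"
    using comb[OF OPT3_mod_4_odd[OF r(6) not_square_mod_3[OF r(2)]] OPT3_mod_9[OF r(2)] c(4)] by simp
  show "144 dvd OPT3_gf $ (24 * n + 23)"
    using comb[OF OPT3_mod_16[OF r(5)] OPT3_mod_9[OF r(3)] c(5)] by simp
qed

end
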